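(* Let $(C,\Delta,\gamma,\alpha)$ be a post-Hom-Lie coalgebra (with Hom-Lie cobracket $\gamma$), and define $\tilde\Delta:C\to C\otimes C$ by $\tilde\Delta(x)=\Delta(x)+\frac12\gamma(x)$ for all $x\in C$. Then $(C,\tilde\Delta,\alpha)$ is an admissible Hom-Lie coalgebra if and only if $$(1+\xi+\xi^2)\big(as_{\tilde\Delta}(x)-(\tau\otimes I)\,as_{\tilde\Delta}(x)\big)=0\quad\text{for all }x\in C,$$ where $as_{\tilde\Delta}=(\tilde\Delta\otimes\alpha)\circ\tilde\Delta-(\alpha\otimes\tilde\Delta)\circ\tilde\Delta$.
   Context: All vector spaces are over a field $\mathbb{F}$ of characteristic $0$; $I$ is the identity map, $\tau(x\otimes y)=y\otimes x$, $\xi(x\otimes y\otimes z)=y\otimes z\otimes x$, $\xi^2(x\otimes y\otimes z)=z\otimes x\otimes y$. A triple $(C,\tilde\Delta,\alpha)$ with linear maps $\tilde\Delta:C\to C\otimes C$, $\alpha:C\to C$ is an admissible Hom-Lie coalgebra if $\tilde\gamma=(1-\tau)\circ\tilde\Delta$ satisfies the Hom-co-Jacobi identity $(1+\xi+\xi^2)\circ(\alpha\otimes\tilde\gamma)\circ\tilde\gamma=0$. A post-Hom-Lie coalgebra is a vector space $C$ with linear maps $\Delta,\gamma:C\to C\otimes C$ and $\alpha:C\to C$ such that (i) $\gamma=-\tau\circ\gamma$ and $\gamma\circ\alpha=(\alpha\otimes\alpha)\circ\gamma$; (ii) $(1+\xi+\xi^2)\circ(\alpha\otimes\gamma)\circ\gamma=0$;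 (iii) $(\alpha\otimes\gamma)\circ\Delta-(\Delta\otimes\alpha)\circ\gamma-(\tau\otimes I)\circ(\alpha\otimes\Delta)\circ\gamma=0$; (iv) $(\Delta\otimes\alpha)\circ\Delta-(\alpha\otimes\Delta)\circ\Delta-(\tau\otimes I)\circ(\Delta\otimes\alpha)\circ\Delta+(\tau\otimes I)\circ(\alpha\otimes\Delta)\circ\Delta+(\gamma\otimes\alpha)\circ\Delta=0$. *)

theory Defs
  imports Complex_Main "HOL-Library.Poly_Mapping"
begin

text \<open>
  The formal linear combinations of pairs form the free vector space on \<open>V \<times> W\<close>; a tensor product of
  \<open>V\<close> and \<open>W\<close> is its quotient by the subspace spanned by the bilinearity relations. Since this
  quotient depends on the scalar multiplications, it is not a HOL type; instead, being a tensor product is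
  a predicate on a vector space \<open>T\<close> with a map \<open>t\<close>: the linear extension of \<open>t\<close> to the free vector
  space induces an isomorphism from that quotient onto \<open>T\<close>.
\<close>

definition free_scale :: "'k::field \<Rightarrow> ('a \<Rightarrow>\<^sub>0 'k) \<Rightarrow> ('a \<Rightarrow>\<^sub>0 'k)" where
  "free_scale c = Poly_Mapping.map ((*) c)"

definition free_extend :: "('k::field \<Rightarrow> 'u::ab_group_add \<Rightarrow> 'u) \<Rightarrow> ('a \<Rightarrow> 'u) \<Rightarrow> ('a \<Rightarrow>\<^sub>0 'k) \<Rightarrow> 'u" where
  "free_extend sU f u = (\<Sum>a\<in>Poly_Mapping.keys u. sU (Poly_Mapping.lookup u a) (f a))"

abbreviation pair :: "'v \<Rightarrow> 'w \<Rightarrow> ('v \<times> 'w \<Rightarrow>\<^sub>0 'k::field)" where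
  "pair v w \<equiv> Poly_Mapping.single (v, w) 1"

definition bilinear_relations ::
  "('k::field \<Rightarrow> 'v::ab_group_add \<Rightarrow> 'v) \<Rightarrow> ('k \<Rightarrow> 'w::ab_group_add \<Rightarrow> 'w) \<Rightarrow> ('v \<times> 'w \<Rightarrow>\<^sub>0 'k) set" where
  "bilinear_relations sV sW =
     {pair (v + v') w - pair v w - pair v' w | v v' w. True} \<union>
     {pair v (w + w') - pair v w - pair v w' | v w w'. True} \<union>
     {pair (sV c v) w - free_scale c (pair v w) | c v w. True} \<union>
     {pair v (sW c w) - free_scale c (pair v w) | c v w. True}"

definition tensor_product ::
  "('k::field \<Rightarrow> 'v::ab_group_add \<Rightarrow> 'v) \<Rightarrow> ('k \<Rightarrow> 'w::ab_group_add \<Rightarrow> 'w) \<Rightarrow>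
   ('k \<Rightarrow> 't::ab_group_add \<Rightarrow> 't) \<Rightarrow> ('v \<Rightarrow> 'w \<Rightarrow> 't) \<Rightarrow> bool" where
  "tensor_product sV sW sT t \<longleftrightarrow>
     vector_space sV \<and> vector_space sW \<and> vector_space sT \<and>
     surj (free_extend sT (case_prod t)) \<and>
     {u. free_extend sT (case_prod t) u = 0} = module.span free_scale (bilinear_relations sV sW)"

text \<open>The linear map on the tensor product \<open>(T, t)\<close> with \<open>t v w \<mapsto> b v w\<close>, for bilinear \<open>b\<close>.\<close>

definition tensor_lift ::
  "('k::field \<Rightarrow> 't::ab_group_add \<Rightarrow> 't) \<Rightarrow> ('k \<Rightarrow> 'u::ab_group_add \<Rightarrow> 'u) \<Rightarrow>
   ('v \<Rightarrow> 'w \<Rightarrow> 't) \<Rightarrow> ('v \<Rightarrow> 'w \<Rightarrow> 'u) \<Rightarrow> 't \<Rightarrow> 'u" where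
  "tensor_lift sT sU t b = (THE h. Vector_Spaces.linear sT sU h \<and> (\<forall>v w. h (t v w) = b v w))"

text \<open>
  A vector space \<open>C\<close> (type \<open>'c\<close>) with \<open>C \<otimes> C\<close> (type \<open>'d\<close>) and \<open>C \<otimes> C \<otimes> C\<close> (type \<open>'e\<close>). The latter
  is a tensor product both of \<open>C\<close> and \<open>C \<otimes> C\<close> and of \<open>C \<otimes> C\<close> and \<open>C\<close>, and the usual
  identification \<open>(x \<otimes> y) \<otimes> z = x \<otimes> (y \<otimes> z)\<close> holds in it.
\<close>

record ('k, 'c, 'd, 'e) tensor_cube =
  scale1 :: "'k \<Rightarrow> 'c \<Rightarrow> 'c"
  scale2 :: "'k \<Rightarrow> 'd \<Rightarrow> 'd"
  scale3 :: "'k \<Rightarrow> 'e \<Rightarrow> 'e"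
  tens :: "'c \<Rightarrow> 'c \<Rightarrow> 'd"
  tens_left :: "'c \<Rightarrow> 'd \<Rightarrow> 'e"
  tens_right :: "'d \<Rightarrow> 'c \<Rightarrow> 'e"

definition is_tensor_cube ::
  "('k::field, 'c::ab_group_add, 'd::ab_group_add, 'e::ab_group_add) tensor_cube \<Rightarrow> bool" where
  "is_tensor_cube T \<longleftrightarrow>
     tensor_product (scale1 T) (scale1 T) (scale2 T) (tens T) \<and>
     tensor_product (scale1 T) (scale2 T) (scale3 T) (tens_left T) \<and>
     tensor_product (scale2 T) (scale1 T) (scale3 T) (tens_right T) \<and>
     (\<forall>x y z. tens_right T (tens T x y) z = tens_left T x (tens T y z))"

text \<open>
  \<open>map11 T f g = f \<otimes> g : C \<otimes> C \<rightarrow> C \<otimes> C\<close>, \<open>map12 T f D = f \<otimes> D : C \<otimes> C \<rightarrow> C \<otimes> C \<otimes> C\<close>,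
  \<open>map21 T D f = D \<otimes> f : C \<otimes> C \<rightarrow> C \<otimes> C \<otimes> C\<close> and \<open>map33 T F f = F \<otimes> f : C \<otimes> C \<otimes> C \<rightarrow> C \<otimes> C \<otimes> C\<close>,
  for linear \<open>f, g : C \<rightarrow> C\<close>, \<open>D : C \<rightarrow> C \<otimes> C\<close> and \<open>F : C \<otimes> C \<rightarrow> C \<otimes> C\<close>.
\<close>

definition map11 ::
  "('k::field, 'c, 'd::ab_group_add, 'e) tensor_cube \<Rightarrow> ('c \<Rightarrow> 'c) \<Rightarrow> ('c \<Rightarrow> 'c) \<Rightarrow> 'd \<Rightarrow> 'd" where
  "map11 T f g = tensor_lift (scale2 T) (scale2 T) (tens T) (\<lambda>x y. tens T (f x) (g y))"

definition map12 ::
  "('k::field, 'c, 'd::ab_group_add, 'e::ab_group_add) tensor_cube \<Rightarrow> ('c \<Rightarrow> 'c) \<Rightarrow> ('c \<Rightarrow> 'd) \<Rightarrow> 'd \<Rightarrow> 'e" where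
  "map12 T f D = tensor_lift (scale2 T) (scale3 T) (tens T) (\<lambda>x y. tens_left T (f x) (D y))"

definition map21 ::
  "('k::field, 'c, 'd::ab_group_add, 'e::ab_group_add) tensor_cube \<Rightarrow> ('c \<Rightarrow> 'd) \<Rightarrow> ('c \<Rightarrow> 'c) \<Rightarrow> 'd \<Rightarrow> 'e" where
  "map21 T D f = tensor_lift (scale2 T) (scale3 T) (tens T) (\<lambda>x y. tens_right T (D x) (f y))"

definition map33 ::
  "('k::field, 'c, 'd, 'e::ab_group_add) tensor_cube \<Rightarrow> ('d \<Rightarrow> 'd) \<Rightarrow> ('c \<Rightarrow> 'c) \<Rightarrow> 'e \<Rightarrow> 'e" where
  "map33 T F f = tensor_lift (scale3 T) (scale3 T) (tens_right T) (\<lambda>t z. tens_right T (F t) (f z))"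

definition flip :: "('k::field, 'c, 'd::ab_group_add, 'e) tensor_cube \<Rightarrow> 'd \<Rightarrow> 'd" where
  "flip T = tensor_lift (scale2 T) (scale2 T) (tens T) (\<lambda>x y. tens T y x)"

definition cyc :: "('k::field, 'c, 'd, 'e::ab_group_add) tensor_cube \<Rightarrow> 'e \<Rightarrow> 'e" where
  "cyc T = (THE h. Vector_Spaces.linear (scale3 T) (scale3 T) h \<and>
     (\<forall>x y z. h (tens_left T x (tens T y z)) = tens_left T y (tens T z x)))"

definition cyc_sum :: "('k::field, 'c, 'd, 'e::ab_group_add) tensor_cube \<Rightarrow> 'e \<Rightarrow> 'e" where
  "cyc_sum T u = u + cyc T u + (cyc T \<circ> cyc T) u"

definition hom_coJacobi ::
  "('k::field, 'c, 'd::ab_group_add, 'e::ab_group_add) tensor_cube \<Rightarrow> ('c \<Rightarrow> 'd) \<Rightarrow> ('c \<Rightarrow> 'c) \<Rightarrow> bool" where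
  "hom_coJacobi T \<gamma> \<alpha> \<longleftrightarrow> (\<forall>x. cyc_sum T (map12 T \<alpha> \<gamma> (\<gamma> x)) = 0)"

definition admissible_hom_Lie_coalgebra ::
  "('k::field, 'c::ab_group_add, 'd::ab_group_add, 'e::ab_group_add) tensor_cube \<Rightarrow>
   ('c \<Rightarrow> 'd) \<Rightarrow> ('c \<Rightarrow> 'c) \<Rightarrow> bool" where
  "admissible_hom_Lie_coalgebra T \<Delta> \<alpha> \<longleftrightarrow>
     Vector_Spaces.linear (scale1 T) (scale2 T) \<Delta> \<and>
     Vector_Spaces.linear (scale1 T) (scale1 T) \<alpha> \<and>
     hom_coJacobi T (\<lambda>x. \<Delta> x - flip T (\<Delta> x)) \<alpha>"

definition post_hom_Lie_coalgebra ::
  "('k::field, 'c::ab_group_add, 'd::ab_group_add, 'e::ab_group_add) tensor_cube \<Rightarrow>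
   ('c \<Rightarrow> 'd) \<Rightarrow> ('c \<Rightarrow> 'd) \<Rightarrow> ('c \<Rightarrow> 'c) \<Rightarrow> bool" where
  "post_hom_Lie_coalgebra T \<Delta> \<gamma> \<alpha> \<longleftrightarrow>
     Vector_Spaces.linear (scale1 T) (scale2 T) \<Delta> \<and>
     Vector_Spaces.linear (scale1 T) (scale2 T) \<gamma> \<and>
     Vector_Spaces.linear (scale1 T) (scale1 T) \<alpha> \<and>
     (\<forall>x. \<gamma> x = - flip T (\<gamma> x)) \<and>
     (\<forall>x. \<gamma> (\<alpha> x) = map11 T \<alpha> \<alpha> (\<gamma> x)) \<and>
     hom_coJacobi T \<gamma> \<alpha> \<and>
     (\<forall>x. map12 T \<alpha> \<gamma> (\<Delta> x) - map21 T \<Delta> \<alpha> (\<gamma> x)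
          - map33 T (flip T) id (map12 T \<alpha> \<Delta> (\<gamma> x)) = 0) \<and>
     (\<forall>x. map21 T \<Delta> \<alpha> (\<Delta> x) - map12 T \<alpha> \<Delta> (\<Delta> x)
          - map33 T (flip T) id (map21 T \<Delta> \<alpha> (\<Delta> x))
          + map33 T (flip T) id (map12 T \<alpha> \<Delta> (\<Delta> x))
          + map21 T \<gamma> \<alpha> (\<Delta> x) = 0)"

definition hom_coassociator ::
  "('k::field, 'c, 'd::ab_group_add, 'e::ab_group_add) tensor_cube \<Rightarrow>
   ('c \<Rightarrow> 'd) \<Rightarrow> ('c \<Rightarrow> 'c) \<Rightarrow> 'c \<Rightarrow> 'e" where
  "hom_coassociator T \<Delta> \<alpha> x = map21 T \<Delta> \<alpha> (\<Delta> x) - map12 T \<alpha> \<Delta> (\<Delta> x)"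

text \<open>
  \<^const>\<open>tensor_lift\<close> and \<^const>\<open>cyc\<close> are well defined, and tensor cubes exist: free vector
  spaces, with the tensors of basis vectors as basis.
\<close>

lemma lookup_free_scale: "Poly_Mapping.lookup (free_scale c u) a = c * Poly_Mapping.lookup u a"
  by (simp add: free_scale_def Poly_Mapping.map.rep_eq when_def)

lemma vector_space_free: "vector_space (free_scale :: 'k::field \<Rightarrow> ('a \<Rightarrow>\<^sub>0 'k) \<Rightarrow> _)"
  by unfold_locales
    (auto intro!: poly_mapping_eqI simp: lookup_free_scale lookup_add algebra_simps)

lemma free_extend_superset:
  assumes "vector_space sU" "finite A" "Poly_Mapping.keys u \<subseteq> A"
  shows "free_extend sU f u = (\<Sum>a\<in>A. sU (Poly_Mapping.lookup u a) (f a))"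
proof -
  interpret vector_space sU by fact
  show ?thesis unfolding free_extend_def
    by (rule sum.mono_neutral_left) (use assms in \<open>auto simp: in_keys_iff\<close>)
qed

lemma linear_free_extend:
  fixes sU :: "'k::field \<Rightarrow> _" and f :: "'a \<Rightarrow> _"
  assumes "vector_space sU"
  shows "Vector_Spaces.linear free_scale sU (free_extend sU f)"
proof -
  interpret vector_space sU by fact
  show ?thesis unfolding Vector_Spaces.linear_iff
  proof (intro conjI allI vector_space_free assms)
    fix u v :: "'a \<Rightarrow>\<^sub>0 'k"
    let ?A = "Poly_Mapping.keys u \<union> Poly_Mapping.keys v"
    have "Poly_Mapping.keys (u + v) \<subseteq> ?A" by (rule keys_add)
    then show "free_extend sU f (u + v) = free_extend sU f u + free_extend sU f v"
      by (simp add: free_extend_superset[OF assms, of ?A] lookup_add scale_left_distrib sum.distrib)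
  next
    fix c :: "'k" and u :: "'a \<Rightarrow>\<^sub>0 'k"
    have "Poly_Mapping.keys (free_scale c u) \<subseteq> Poly_Mapping.keys u"
      by (auto simp: in_keys_iff lookup_free_scale)
    then show "free_extend sU f (free_scale c u) = sU c (free_extend sU f u)"
      by (simp add: free_extend_superset[OF assms, of "Poly_Mapping.keys u"] lookup_free_scale scale_sum_right)
  qed
qed

lemma free_extend_single: "vector_space sU \<Longrightarrow> free_extend sU f (Poly_Mapping.single a 1) = f a"
  by (simp add: free_extend_superset[of sU "{a}"] vector_space_def)

lemma free_extend_linear_comp:
  assumes "Vector_Spaces.linear sT sU h"
  shows "h (free_extend sT f u) = free_extend sU (\<lambda>a. h (f a)) u"
proof -
  interpret Vector_Spaces.linear sT sU h by fact
  show ?thesis by (simp add: free_extend_def sum scale)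
qed

definition bilin ::
  "('k::field \<Rightarrow> 'v::ab_group_add \<Rightarrow> 'v) \<Rightarrow> ('k \<Rightarrow> 'w::ab_group_add \<Rightarrow> 'w) \<Rightarrow>
   ('k \<Rightarrow> 'u::ab_group_add \<Rightarrow> 'u) \<Rightarrow> ('v \<Rightarrow> 'w \<Rightarrow> 'u) \<Rightarrow> bool" where
  "bilin sV sW sU b \<longleftrightarrow>
     (\<forall>v. Vector_Spaces.linear sW sU (b v)) \<and>
     (\<forall>w. Vector_Spaces.linear sV sU (\<lambda>v. b v w))"

lemma kernel_bilin:
  assumes "bilin sV sW sU b" "vector_space sU" "u \<in> module.span free_scale (bilinear_relations sV sW)"
  shows "free_extend sU (case_prod b) u = 0"
proof -
  interpret F: vector_space free_scale by (rule vector_space_free)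
  interpret U: vector_space sU by fact
  interpret L: Vector_Spaces.linear free_scale sU "free_extend sU (case_prod b)"
    by (rule linear_free_extend) fact
  have l: "b (v + v') w = b v w + b v' w" "b (sV c v) w = sU c (b v w)"
    "b v (w + w') = b v w + b v w'" "b v (sW c w) = sU c (b v w)" for v v' w w' c
    using assms(1) unfolding bilin_def Vector_Spaces.linear_iff by auto
  show ?thesis using assms(3)
  proof (rule L.eq_0_on_span[rotated])
    fix x assume "x \<in> bilinear_relations sV sW"
    then show "free_extend sU (case_prod b) x = 0"
      by (auto simp: bilinear_relations_def L.diff L.scale free_extend_single[OF assms(2)] l)
  qed
qed

lemma tensor_eqI:
  assumes "tensor_product sV sW sT t" "Vector_Spaces.linear sT sU h" "Vector_Spaces.linear sT sU h'"
    "\<And>v w. h (t v w) = h' (t v w)"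
  shows "h x = h' x"
proof -
  obtain u where "x = free_extend sT (case_prod t) u"
    using assms(1) unfolding tensor_product_def by (metis surjD)
  moreover have "(\<lambda>a. h (case_prod t a)) = (\<lambda>a. h' (case_prod t a))" using assms(4) by auto
  ultimately show ?thesis by (simp add: free_extend_linear_comp[OF assms(2)] free_extend_linear_comp[OF assms(3)])
qed

lemma tensor_bilin:
  assumes "tensor_product sV sW sT t" shows "bilin sV sW sT t"
proof -
  interpret F: vector_space free_scale by (rule vector_space_free)
  interpret V: vector_space sV using assms by (simp add: tensor_product_def)
  interpret W: vector_space sW using assms by (simp add: tensor_product_def)
  have vT: "vector_space sT" using assms by (simp add: tensor_product_def)
  then interpret T: vector_space sT .
  interpret L: Vector_Spaces.linear free_scale sT "free_extend sT (case_prod t)"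
    by (rule linear_free_extend) (rule vT)
  have k: "free_extend sT (case_prod t) r = 0" if "r \<in> bilinear_relations sV sW" for r
    using assms F.span_base[OF that] unfolding tensor_product_def by blast
  have "t (v + v') w = t v w + t v' w" for v v' w
  proof -
    have "pair (v + v') w - pair v w - pair v' w \<in> bilinear_relations sV sW" unfolding bilinear_relations_def by blast
    from k[OF this] show ?thesis by (simp add: L.diff L.scale free_extend_single[OF vT] diff_eq_eq add.commute)
  qed
  moreover have "t v (w + w') = t v w + t v w'" for v w w'
  proof -
    have "pair v (w + w') - pair v w - pair v w' \<in> bilinear_relations sV sW" unfolding bilinear_relations_def by blast
    from k[OF this] show ?thesis by (simp add: L.diff L.scale free_extend_single[OF vT] diff_eq_eq add.commute)
  qed
  moreover have "t (sV c v) w = sT c (t v w)" for c v w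
  proof -
    have "pair (sV c v) w - free_scale c (pair v w) \<in> bilinear_relations sV sW" unfolding bilinear_relations_def by blast
    from k[OF this] show ?thesis by (simp add: L.diff L.scale free_extend_single[OF vT] diff_eq_eq add.commute)
  qed
  moreover have "t v (sW c w) = sT c (t v w)" for c v w
  proof -
    have "pair v (sW c w) - free_scale c (pair v w) \<in> bilinear_relations sV sW" unfolding bilinear_relations_def by blast
    from k[OF this] show ?thesis by (simp add: L.diff L.scale free_extend_single[OF vT] diff_eq_eq add.commute)
  qed
  ultimately show ?thesis unfolding bilin_def Vector_Spaces.linear_iff
    by (auto intro: V.vector_space_axioms W.vector_space_axioms vT)
qed

lemma tensor_lift:
  assumes t: "tensor_product sV sW sT t" and b: "bilin sV sW sU b"
  shows "Vector_Spaces.linear sT sU (tensor_lift sT sU t b)" "tensor_lift sT sU t b (t v w) = b v w"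
proof -
  interpret F: vector_space free_scale by (rule vector_space_free)
  have vT: "vector_space sT" using t by (simp add: tensor_product_def)
  then interpret T: vector_space sT .
  have vU: "vector_space sU" using b unfolding bilin_def Vector_Spaces.linear_iff by auto
  then interpret U: vector_space sU .
  let ?e = "free_extend sT (case_prod t)" and ?f = "free_extend sU (case_prod b)"
  interpret L: Vector_Spaces.linear free_scale sT ?e by (rule linear_free_extend) (rule vT)
  interpret M: Vector_Spaces.linear free_scale sU ?f by (rule linear_free_extend) (rule vU)
  define h where "h x = ?f (SOME u. ?e u = x)" for x
  have k: "?f u = ?f u'" if "?e u = ?e u'" for u u'
  proof -
    have "?e (u - u') = 0" using that by (simp add: L.diff)
    then have "?f (u - u') = 0" using kernel_bilin[OF b vU] t unfolding tensor_product_def by blast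
    then show ?thesis by (simp add: M.diff)
  qed
  have h: "h (?e u) = ?f u" for u unfolding h_def by (rule k) (metis (mono_tags) someI)
  have s: "\<exists>u. x = ?e u" for x using t unfolding tensor_product_def by (metis surjD)
  have lh: "Vector_Spaces.linear sT sU h"
    unfolding Vector_Spaces.linear_iff
  proof (intro conjI allI vT vU)
    fix x y c
    obtain u w where "x = ?e u" "y = ?e w" using s by metis
    then show "h (x + y) = h x + h y" "h (sT c x) = sU c (h x)"
      by (simp_all add: h M.add M.scale flip: L.add L.scale)
  qed
  have ht: "h (t v w) = b v w" for v w
    using h[of "pair v w"] by (simp add: free_extend_single vT vU)
  have ex1: "\<exists>!h. Vector_Spaces.linear sT sU h \<and> (\<forall>v w. h (t v w) = b v w)"
  proof (rule ex1I[of _ h])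
    fix h' assume "Vector_Spaces.linear sT sU h' \<and> (\<forall>v w. h' (t v w) = b v w)"
    then show "h' = h" by - (rule ext, rule tensor_eqI[OF t _ lh], simp_all add: ht)
  qed (use lh ht in auto)
  from theI'[OF ex1] show "Vector_Spaces.linear sT sU (tensor_lift sT sU t b)" "tensor_lift sT sU t b (t v w) = b v w"
    unfolding tensor_lift_def by auto
qed

lemma bilinI:
  assumes "vector_space sV" "vector_space sW" "vector_space sU"
   "\<And>v v' w. b (v+v') w = b v w + b v' w" "\<And>v w w'. b v (w+w') = b v w + b v w'"
   "\<And>c v w. b (sV c v) w = sU c (b v w)" "\<And>c v w. b v (sW c w) = sU c (b v w)"
  shows "bilin sV sW sU b"
  using assms unfolding bilin_def Vector_Spaces.linear_iff by auto

locale cube =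
  fixes T :: "('k::field_char_0, 'c::ab_group_add, 'd::ab_group_add, 'e::ab_group_add) tensor_cube"
  assumes T: "is_tensor_cube T"
begin

abbreviation "s1 \<equiv> scale1 T"
abbreviation "s2 \<equiv> scale2 T"
abbreviation "s3 \<equiv> scale3 T"

lemma tp: "tensor_product s1 s1 s2 (tens T)" "tensor_product s1 s2 s3 (tens_left T)"
  "tensor_product s2 s1 s3 (tens_right T)" "tens_right T (tens T x y) z = tens_left T x (tens T y z)"
  using T unfolding is_tensor_cube_def by auto

sublocale V1: vector_space s1 using tp(1) by (simp add: tensor_product_def)
sublocale V2: vector_space s2 using tp(1) by (simp add: tensor_product_def)
sublocale V3: vector_space s3 using tp(2) by (simp add: tensor_product_def)
lemmas vs = V1.vector_space_axioms V2.vector_space_axioms V3.vector_space_axioms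

lemma lin:
  "tens T (x+x') y = tens T x y + tens T x' y" "tens T x (y+y') = tens T x y + tens T x y'"
  "tens T (s1 c x) y = s2 c (tens T x y)" "tens T x (s1 c y) = s2 c (tens T x y)"
  "tens_left T (x+x') t = tens_left T x t + tens_left T x' t" "tens_left T x (t+t') = tens_left T x t + tens_left T x t'"
  "tens_left T (s1 c x) t = s3 c (tens_left T x t)" "tens_left T x (s2 c t) = s3 c (tens_left T x t)"
  "tens_right T (t+t') x = tens_right T t x + tens_right T t' x" "tens_right T t (x+x') = tens_right T t x + tens_right T t x'"
  "tens_right T (s2 c t) x = s3 c (tens_right T t x)" "tens_right T t (s1 c x) = s3 c (tens_right T t x)"
  using tensor_bilin[OF tp(1)] tensor_bilin[OF tp(2)] tensor_bilin[OF tp(3)]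
  unfolding bilin_def Vector_Spaces.linear_iff by auto

lemma map11:
  assumes "Vector_Spaces.linear s1 s1 f" "Vector_Spaces.linear s1 s1 g"
  shows "Vector_Spaces.linear s2 s2 (map11 T f g)" (is ?A) "map11 T f g (tens T x y) = tens T (f x) (g y)" (is ?B)
proof -
  have b: "bilin s1 s1 s2 (\<lambda>x y. tens T (f x) (g y))"
    by (intro bilinI vs) (use assms in \<open>auto simp: lin Vector_Spaces.linear_iff\<close>)
  from tensor_lift[OF tp(1) b] show ?A ?B
    unfolding map11_def by auto
qed

lemma map12:
  assumes "Vector_Spaces.linear s1 s1 f" "Vector_Spaces.linear s1 s2 D"
  shows "Vector_Spaces.linear s2 s3 (map12 T f D)" (is ?A) "map12 T f D (tens T x y) = tens_left T (f x) (D y)" (is ?B)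
proof -
  have b: "bilin s1 s1 s3 (\<lambda>x y. tens_left T (f x) (D y))"
    by (intro bilinI vs) (use assms in \<open>auto simp: lin Vector_Spaces.linear_iff\<close>)
  from tensor_lift[OF tp(1) b] show ?A ?B
    unfolding map12_def by auto
qed

lemma map21:
  assumes "Vector_Spaces.linear s1 s1 f" "Vector_Spaces.linear s1 s2 D"
  shows "Vector_Spaces.linear s2 s3 (map21 T D f)" (is ?A) "map21 T D f (tens T x y) = tens_right T (D x) (f y)" (is ?B)
proof -
  have b: "bilin s1 s1 s3 (\<lambda>x y. tens_right T (D x) (f y))"
    by (intro bilinI vs) (use assms in \<open>auto simp: lin Vector_Spaces.linear_iff\<close>)
  from tensor_lift[OF tp(1) b] show ?A ?B
    unfolding map21_def by auto
qed

lemma map33: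
  assumes "Vector_Spaces.linear s1 s1 f" "Vector_Spaces.linear s2 s2 F"
  shows "Vector_Spaces.linear s3 s3 (map33 T F f)" (is ?A) "map33 T F f (tens_right T t z) = tens_right T (F t) (f z)" (is ?B)
proof -
  have b: "bilin s2 s1 s3 (\<lambda>x y. tens_right T (F x) (f y))"
    by (intro bilinI vs) (use assms in \<open>auto simp: lin Vector_Spaces.linear_iff\<close>)
  from tensor_lift[OF tp(3) b] show ?A ?B
    unfolding map33_def by auto
qed

lemma flip:
  shows "Vector_Spaces.linear s2 s2 (flip T)" "flip T (tens T x y) = tens T y x"
  unfolding flip_def
  by (auto intro!: tensor_lift[OF tp(1)] bilinI vs simp: lin)

lemma ext2:
  assumes "Vector_Spaces.linear s2 s h" "Vector_Spaces.linear s2 s h'" "\<And>v w. h (tens T v w) = h' (tens T v w)"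
  shows "h x = h' x" by (rule tensor_eqI[OF tp(1)]; fact)

lemma ext3:
  assumes "Vector_Spaces.linear s3 s h" "Vector_Spaces.linear s3 s h'"
   "\<And>v w u. h (tens_left T v (tens T w u)) = h' (tens_left T v (tens T w u))"
  shows "h x = h' x"
proof (rule tensor_eqI[OF tp(2) assms(1,2)])
  fix v w
  show "h (tens_left T v w) = h' (tens_left T v w)"
    by (rule ext2[of s]) (use assms vs in \<open>auto simp: Vector_Spaces.linear_iff lin\<close>)
qed

lemma cyc:
  shows "Vector_Spaces.linear s3 s3 (cyc T)" "cyc T (tens_left T x t) = tens_right T t x"
proof -
  let ?h = "tensor_lift s3 s3 (tens_left T) (\<lambda>x t. tens_right T t x)"
  have b: "bilin s1 s2 s3 (\<lambda>x t. tens_right T t x)" by (intro bilinI) (auto simp: lin vs)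
  note h = tensor_lift[OF tp(2) b]
  have "\<exists>!h. Vector_Spaces.linear s3 s3 h \<and> (\<forall>x y z. h (tens_left T x (tens T y z)) = tens_left T y (tens T z x))"
  proof (rule ex1I[of _ ?h])
    fix g assume "Vector_Spaces.linear s3 s3 g \<and> (\<forall>x y z. g (tens_left T x (tens T y z)) = tens_left T y (tens T z x))"
    then show "g = ?h" by - (rule ext, rule ext3[OF _ h(1)], simp_all add: h tp(4))
  qed (auto simp: h tp(4))
  then have "cyc T = ?h" unfolding cyc_def
    by (rule the1_equality) (auto simp: h tp(4))
  then show "Vector_Spaces.linear s3 s3 (cyc T)" "cyc T (tens_left T x t) = tens_right T t x"
    by (auto simp: h)
qed

end

lemma free_basis_induct:
  fixes u :: "'a \<Rightarrow>\<^sub>0 'k::field"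
  assumes "P 0" "\<And>u v. P u \<Longrightarrow> P v \<Longrightarrow> P (u + v)" "\<And>c u. P u \<Longrightarrow> P (free_scale c u)"
    "\<And>a. P (Poly_Mapping.single a 1)"
  shows "P u"
proof -
  have *: "P (\<Sum>a\<in>A. free_scale (Poly_Mapping.lookup u a) (Poly_Mapping.single a 1))" if "finite A" for A
    using that by (induction A) (auto intro: assms)
  have "u = (\<Sum>a\<in>Poly_Mapping.keys u. free_scale (Poly_Mapping.lookup u a) (Poly_Mapping.single a 1))"
    by (rule poly_mapping_eqI) (auto simp: lookup_sum lookup_free_scale lookup_single when_def in_keys_iff sum.delta' if_distrib cong: if_cong)
  then show ?thesis using * finite_keys by metis
qed

definition free_tensor :: "('i \<times> 'j \<Rightarrow> 'm) \<Rightarrow> ('i \<Rightarrow>\<^sub>0 'k::field) \<Rightarrow> ('j \<Rightarrow>\<^sub>0 'k) \<Rightarrow> ('m \<Rightarrow>\<^sub>0 'k)" where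
  "free_tensor \<phi> u v = free_extend free_scale (\<lambda>i. free_extend free_scale (\<lambda>j. Poly_Mapping.single (\<phi> (i,j)) 1) v) u"

lemma free_tensor_single: "free_tensor \<phi> (Poly_Mapping.single i 1) (Poly_Mapping.single j 1) = Poly_Mapping.single (\<phi> (i,j)) 1"
  by (simp add: free_tensor_def free_extend_single vector_space_free)

lemma free_tensor_lin: "free_tensor \<phi> (u + u') v = free_tensor \<phi> u v + free_tensor \<phi> u' v" "free_tensor \<phi> (free_scale c u) v = free_scale c (free_tensor \<phi> u v)"
   "free_tensor \<phi> u (v + v') = free_tensor \<phi> u v + free_tensor \<phi> u v'" "free_tensor \<phi> u (free_scale c v) = free_scale c (free_tensor \<phi> u v)"
proof -
  interpret F: vector_space free_scale by (rule vector_space_free)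
  have l: "free_extend free_scale f (x + y) = free_extend free_scale f x + free_extend free_scale f y"
    "free_extend free_scale f (free_scale c x) = free_scale c (free_extend free_scale f x)"
    for f :: "'x \<Rightarrow> 'y \<Rightarrow>\<^sub>0 'z::field" and x y c
    using linear_free_extend[OF vector_space_free, of f] unfolding Vector_Spaces.linear_iff by auto
  show "free_tensor \<phi> (u + u') v = free_tensor \<phi> u v + free_tensor \<phi> u' v" "free_tensor \<phi> (free_scale c u) v = free_scale c (free_tensor \<phi> u v)"
    by (simp_all add: free_tensor_def l)
  show "free_tensor \<phi> u (v + v') = free_tensor \<phi> u v + free_tensor \<phi> u v'" "free_tensor \<phi> u (free_scale c v) = free_scale c (free_tensor \<phi> u v)"
    unfolding free_tensor_def l unfolding free_extend_def
    by (simp_all add: F.scale_right_distrib sum.distrib F.scale_sum_right ac_simps)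
qed

lemma free_scale_0 [simp]: "free_scale 0 u = 0" by (rule poly_mapping_eqI) (simp add: lookup_free_scale)

lemma free_tensor_0: "free_tensor \<phi> 0 w = 0" "free_tensor \<phi> v 0 = 0" for v :: "'i \<Rightarrow>\<^sub>0 'k::field" and w :: "'j \<Rightarrow>\<^sub>0 'k"
proof -
  show "free_tensor \<phi> 0 w = 0" "free_tensor \<phi> v 0 = 0" using free_tensor_lin(2)[of \<phi> 0 0 w] free_tensor_lin(4)[of \<phi> v 0 0] by simp_all
qed

lemma free_tensor_product:
  fixes \<phi> :: "'i \<times> 'j \<Rightarrow> 'm"
  assumes "bij \<phi>"
  shows "tensor_product free_scale free_scale (free_scale :: 'k::field \<Rightarrow> _) (free_tensor \<phi>)"
proof -
  let ?b = "free_tensor \<phi> :: ('i \<Rightarrow>\<^sub>0 'k) \<Rightarrow> _"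
  let ?e = "free_extend free_scale (case_prod ?b)"
  let ?R = "bilinear_relations free_scale free_scale :: (('i \<Rightarrow>\<^sub>0 'k) \<times> ('j \<Rightarrow>\<^sub>0 'k) \<Rightarrow>\<^sub>0 'k) set"
  interpret R: vector_space "free_scale :: 'k \<Rightarrow> (('i \<Rightarrow>\<^sub>0 'k) \<times> ('j \<Rightarrow>\<^sub>0 'k) \<Rightarrow>\<^sub>0 'k) \<Rightarrow> _" by (rule vector_space_free)
  define s where "s = free_extend free_scale (\<lambda>m. pair (Poly_Mapping.single (fst (inv \<phi> m)) (1::'k)) (Poly_Mapping.single (snd (inv \<phi> m)) (1::'k)) :: _ \<Rightarrow>\<^sub>0 'k)"
  interpret E: Vector_Spaces.linear free_scale free_scale ?e by (rule linear_free_extend) (rule vector_space_free)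
  interpret S: Vector_Spaces.linear free_scale free_scale s unfolding s_def by (rule linear_free_extend[OF vector_space_free])
  have ss: "s (Poly_Mapping.single (\<phi> (i,j)) 1) = pair (Poly_Mapping.single i 1) (Poly_Mapping.single j 1)" for i j
    using assms by (simp add: s_def free_extend_single vector_space_free bij_is_inj inv_f_f)
  have es: "?e (s q) = q" for q
  proof (induction q rule: free_basis_induct)
    case (4 a)
    obtain i j where a: "a = \<phi> (i,j)" using bij_is_surj[OF assms] by (metis surjD surj_pair)
    show ?case unfolding a by (simp add: ss free_extend_single vector_space_free free_tensor_single)
  qed (auto simp: S.add E.add S.scale E.scale)
  let ?N = "R.span ?R"
  have r0: "pair (v + v') w - pair v w - pair v' w \<in> ?R"  "pair v (w + w') - pair v w - pair v w' \<in> ?R"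
     "pair (free_scale c v) w - free_scale c (pair v w) \<in> ?R" "pair v (free_scale c w) - free_scale c (pair v w) \<in> ?R" for v v' w w' c
    unfolding bilinear_relations_def by blast+
  have r: "pair (v + v') w - pair v w - pair v' w \<in> ?N"  "pair v (w + w') - pair v w - pair v w' \<in> ?N"
     "pair (free_scale c v) w - free_scale c (pair v w) \<in> ?N" "pair v (free_scale c w) - free_scale c (pair v w) \<in> ?N" for v v' w w' c
    by (intro R.span_base r0)+
  have z1: "pair 0 w \<in> ?N" for w using r(3)[of 0 0 w] by simp
  have z2: "pair v 0 \<in> ?N" for v using r(4)[of v 0 0] by simp
  have g: "pair v w - s (?b v w) \<in> ?N" for v w
  proof (induction v rule: free_basis_induct)
    case 1 then show ?case by (simp add: free_tensor_0 z1 S.zero)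
  next
    case (2 u v)
    from R.span_add[OF r(1)[of u v w] R.span_add[OF 2]] show ?case by (simp add: free_tensor_lin S.add algebra_simps)
  next
    case (3 c u)
    from R.span_add[OF r(3)[of c u w] R.span_scale[OF 3, of c]] show ?case by (simp add: free_tensor_lin S.scale R.scale_right_diff_distrib)
  next
    case (4 a)
    show ?case
    proof (induction w rule: free_basis_induct)
      case 1 then show ?case by (simp add: free_tensor_0 z2 S.zero)
    next
      case (2 u v)
      from R.span_add[OF r(2)[of "Poly_Mapping.single a 1" u v] R.span_add[OF 2]] show ?case by (simp add: free_tensor_lin S.add algebra_simps)
    next
      case (3 c u)
      from R.span_add[OF r(4)[of "Poly_Mapping.single a 1" c u] R.span_scale[OF 3, of c]] show ?case by (simp add: free_tensor_lin S.scale R.scale_right_diff_distrib)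
    next
      case (4 b)
      show ?case by (simp add: free_tensor_single ss R.span_zero)
    qed
  qed
  have p: "p - s (?e p) \<in> ?N" for p
  proof (induction p rule: free_basis_induct)
    case 1 then show ?case by (simp add: S.zero E.zero R.span_zero)
  next
    case (2 u v)
    from R.span_add[OF 2] show ?case by (simp add: E.add S.add algebra_simps)
  next
    case (3 c u)
    from R.span_scale[OF 3, of c] show ?case by (simp add: E.scale S.scale R.scale_right_diff_distrib)
  next
    case (4 a)
    obtain v w where "a = (v,w)" by force
    then show ?case using g[of v w] by (simp add: free_extend_single vector_space_free)
  qed
  have "bilin free_scale free_scale free_scale ?b"
    by (intro bilinI vector_space_free free_tensor_lin)
  note k = kernel_bilin[OF this vector_space_free]
  have "{u. ?e u = 0} = ?N"
  proof (intro set_eqI iffI)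
    fix u assume "u \<in> {u. ?e u = 0}"
    then show "u \<in> ?N" using p[of u] by (simp add: S.zero)
  qed (use k in auto)
  moreover have "surj ?e" using es by (metis surjI)
  ultimately show ?thesis by (simp add: tensor_product_def vector_space_free)
qed

lemma tensor_cube_exists:
  "is_tensor_cube \<lparr>scale1 = free_scale :: 'k::field_char_0 \<Rightarrow> ('i \<Rightarrow>\<^sub>0 'k) \<Rightarrow> _, scale2 = free_scale, scale3 = free_scale,
     tens = free_tensor id, tens_left = free_tensor id, tens_right = free_tensor (\<lambda>((i,j),k). (i,(j,k)))\<rparr>"
proof -
  have "bij (\<lambda>((i::'i,j::'i),k::'i). (i,(j,k)))"
    by (rule bij_betw_byWitness[of _ "\<lambda>(i,(j,k)). ((i,j),k)"]) auto
  moreover have "free_tensor (\<lambda>((i,j),k). (i,(j,k))) (free_tensor id x y) z = free_tensor id x (free_tensor id y z)" for x y z :: "'i \<Rightarrow>\<^sub>0 'k"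
  proof (induction x rule: free_basis_induct)
    case (4 a)
    show ?case
    proof (induction y rule: free_basis_induct)
      case (4 b)
      show ?case
      proof (induction z rule: free_basis_induct)
      qed (simp_all add: free_tensor_0 free_tensor_lin free_tensor_single)
    qed (simp_all add: free_tensor_0 free_tensor_lin free_tensor_single)
  qed (simp_all add: free_tensor_0 free_tensor_lin free_tensor_single)
  ultimately show ?thesis by (auto simp: is_tensor_cube_def intro!: free_tensor_product)
qed

end

theory Submission
  imports Defs
begin

text \<open>
  The equivalence is a general fact: for any linear \<open>D : C \<rightarrow> C \<otimes> C\<close> and \<open>\<alpha> : C \<rightarrow> C\<close>, the Hom-co-Jacobi
  expression of \<open>(1 - \<tau>) \<circ> D\<close> is minus the cyclic sum of \<open>as\<^sub>D - (\<tau> \<otimes> I) as\<^sub>D\<close>. Up to cyclic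
  permutation, \<open>(\<alpha> \<otimes> D) \<circ> \<tau>\<close> agrees with \<open>D \<otimes> \<alpha>\<close> and \<open>I \<otimes> \<tau>\<close> agrees with \<open>\<tau> \<otimes> I\<close>, so the four
  summands of the co-Jacobi expression are those of the antisymmetrized coassociator.
\<close>

context cube
begin

lemma cyc_cyc_cyc: "cyc T (cyc T (cyc T u)) = u"
  by (rule ext3[of s3 "\<lambda>u. cyc T (cyc T (cyc T u))" "\<lambda>u. u"])
    (use cyc(1) vs in \<open>auto simp: Vector_Spaces.linear_iff cyc(2) tp(4)\<close>)

lemma linear_cyc_sum: "Vector_Spaces.linear s3 s3 (cyc_sum T)"
  using cyc(1) by (auto simp: Vector_Spaces.linear_iff cyc_sum_def V3.scale_right_distrib)

text \<open>Since \<open>cyc\<close> has order three, applying it first only permutes the three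
  summands.\<close>

lemma cyc_sum_cyc: "cyc_sum T (cyc T u) = cyc_sum T u"
  by (simp add: cyc_sum_def cyc_cyc_cyc ac_simps)

lemma cyc_sum_tens_right: "cyc_sum T (tens_right T t x) = cyc_sum T (tens_left T x t)"
  by (metis cyc(2) cyc_sum_cyc)

lemma linear_flip_id: "Vector_Spaces.linear s3 s3 (map33 T (flip T) id)"
  by (intro map33(1) V1.linear_id flip(1))

lemma flip_id_tens_right: "map33 T (flip T) id (tens_right T t z) = tens_right T (flip T t) z"
  using map33(2)[OF V1.linear_id flip(1)] by simp

text \<open>For a pure tensor \<open>t\<close>, the arguments of the two cyclic sums are y \<otimes>
  x \<otimes> z and x \<otimes> z \<otimes> y, and \<open>cyc\<close> maps the first to the
  second.\<close>

lemma cyc_sum_flip_id_tens_left: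
  "cyc_sum T (map33 T (flip T) id (tens_left T x t)) = cyc_sum T (tens_left T x (flip T t))"
proof -
  have l: "Vector_Spaces.linear s2 s3 (\<lambda>t. cyc_sum T (map33 T (flip T) id (tens_left T x t)))"
       "Vector_Spaces.linear s2 s3 (\<lambda>t. cyc_sum T (tens_left T x (flip T t)))"
    using linear_cyc_sum linear_flip_id flip(1) vs
    by (auto simp: Vector_Spaces.linear_iff lin)
  have "map33 T (flip T) id (tens_left T x (tens T y z)) = tens_right T (tens T y x) z" for y z
    by (simp add: flip_id_tens_right flip(2) flip: tp(4))
  then have "cyc_sum T (map33 T (flip T) id (tens_left T x (tens T y z)))
      = cyc_sum T (tens_left T x (flip T (tens T y z)))" for y z
    \<comment> \<open>The right side is rotated and then rebracketed: x \<otimes> (z \<otimes> y)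
      becomes (z \<otimes> y) \<otimes> x = z \<otimes> (y \<otimes> x).\<close>
    by (simp add: cyc_sum_tens_right flip(2)) (metis cyc_sum_tens_right tp(4))
  with l show ?thesis by (rule ext2)
qed

text \<open>With an arbitrary \<open>t\<close> in place of \<open>D x\<close>, both sides are linear
  in \<open>t\<close>, so pure tensors suffice.\<close>

lemma cyc_sum_map12_antisym:
  assumes \<alpha>: "Vector_Spaces.linear s1 s1 \<alpha>" and D: "Vector_Spaces.linear s1 s2 D"
  shows "cyc_sum T (map12 T \<alpha> (\<lambda>y. D y - flip T (D y)) (t - flip T t)) =
    - cyc_sum T (map21 T D \<alpha> t - map12 T \<alpha> D t - map33 T (flip T) id (map21 T D \<alpha> t - map12 T \<alpha> D t))"
proof -
  let ?D = "\<lambda>y. D y - flip T (D y)"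
  have lD: "Vector_Spaces.linear s1 s2 ?D"
    using D flip(1) by (auto simp: Vector_Spaces.linear_iff V2.scale_right_diff_distrib)
  note ls = linear_cyc_sum linear_flip_id flip(1) map12(1)[OF \<alpha> D] map12(1)[OF \<alpha> lD] map21(1)[OF \<alpha> D]
  interpret S: Vector_Spaces.linear s3 s3 "cyc_sum T" by (rule linear_cyc_sum)
  interpret F: Vector_Spaces.linear s3 s3 "map33 T (flip T) id" by (rule linear_flip_id)
  interpret M: Vector_Spaces.linear s2 s3 "map12 T \<alpha> ?D" by (rule map12(1)[OF \<alpha> lD])
  have left_diff: "tens_left T x (u - v) = tens_left T x u - tens_left T x v" for x u v
    by (metis add_diff_cancel diff_add_cancel lin(6))
  have "Vector_Spaces.linear s2 s3 (\<lambda>t. cyc_sum T (map12 T \<alpha> ?D (t - flip T t)))"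
      using ls by (auto simp: Vector_Spaces.linear_iff S.diff M.diff V3.scale_right_diff_distrib)
  moreover have "Vector_Spaces.linear s2 s3 (\<lambda>t. - cyc_sum T (map21 T D \<alpha> t - map12 T \<alpha> D t
        - map33 T (flip T) id (map21 T D \<alpha> t - map12 T \<alpha> D t)))"
      using ls by (auto simp: Vector_Spaces.linear_iff S.diff F.diff V3.scale_right_diff_distrib)
  \<comment> \<open>Under the cyclic sum both sides become \<alpha>x \<otimes> Dy - \<alpha>x
    \<otimes> \<tau>Dy - \<alpha>y \<otimes> Dx + \<alpha>y \<otimes> \<tau>Dx.\<close>
  moreover have "cyc_sum T (map12 T \<alpha> ?D (tens T x y - flip T (tens T x y))) =
        - cyc_sum T (map21 T D \<alpha> (tens T x y) - map12 T \<alpha> D (tens T x y)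
          - map33 T (flip T) id (map21 T D \<alpha> (tens T x y) - map12 T \<alpha> D (tens T x y)))" for x y
      by (simp add: M.diff S.diff F.diff left_diff flip(2) map12(2)[OF \<alpha> lD] map12(2)[OF \<alpha> D]
          map21(2)[OF \<alpha> D] flip_id_tens_right cyc_sum_tens_right cyc_sum_flip_id_tens_left)
  ultimately show ?thesis by (rule ext2)
qed

text \<open>This is the preceding identity at \<open>t = D x\<close>; the sign does not affect
  vanishing.\<close>

lemma admissible_hom_Lie_coalgebra_iff:
  assumes "Vector_Spaces.linear s1 s1 \<alpha>" and "Vector_Spaces.linear s1 s2 D"
  shows "admissible_hom_Lie_coalgebra T D \<alpha> \<longleftrightarrow>
    (\<forall>x. cyc_sum T (hom_coassociator T D \<alpha> x - map33 T (flip T) id (hom_coassociator T D \<alpha> x)) = 0)"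
  using assms
  by (simp add: admissible_hom_Lie_coalgebra_def hom_coJacobi_def hom_coassociator_def
      cyc_sum_map12_antisym)

end

theorem proposition4p12:
  fixes T :: "('k::field_char_0, 'c::ab_group_add, 'd::ab_group_add, 'e::ab_group_add) tensor_cube"
    and \<Delta> \<gamma> \<Delta>t :: "'c \<Rightarrow> 'd"
    and \<alpha> :: "'c \<Rightarrow> 'c"
  assumes "is_tensor_cube T"
    and "post_hom_Lie_coalgebra T \<Delta> \<gamma> \<alpha>"
    and "\<And>x. \<Delta>t x = \<Delta> x + scale2 T (1 / 2) (\<gamma> x)"
  shows "admissible_hom_Lie_coalgebra T \<Delta>t \<alpha> \<longleftrightarrow>
    (\<forall>x. cyc_sum T (hom_coassociator T \<Delta>t \<alpha> x
                    - map33 T (flip T) id (hom_coassociator T \<Delta>t \<alpha> x)) = 0)"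
proof -
  interpret cube T by unfold_locales fact
  have \<alpha>: "Vector_Spaces.linear s1 s1 \<alpha>"
    and "Vector_Spaces.linear s1 s2 \<Delta>" "Vector_Spaces.linear s1 s2 \<gamma>"
    using assms(2) by (simp_all add: post_hom_Lie_coalgebra_def)
  then have "Vector_Spaces.linear s1 s2 \<Delta>t"
    by (auto simp: Vector_Spaces.linear_iff assms(3) V2.scale_right_distrib V2.scale_left_commute)
  with \<alpha> show ?thesis by (rule admissible_hom_Lie_coalgebra_iff)
qed

end
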